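(* Let $G\subseteq\binom{[n]}{2}$ be a simple loopless graph on $[n]$ and $c$ an integer. Let $$\mathsf{Shi}(G)=\{x_i-x_j=0: 1\le i<j\le n\}\cup\{x_i-x_j=1: ij\in G\},\qquad \mathsf{Ish}(G)=\{x_i-x_j=0: 1\le i<j\le n\}\cup\{x_1-x_j=i: ij\in G\}$$ in $\mathbb{R}^n$. Then the number of dominant regions of $\mathsf{Shi}(G)$ with exactly $c$ ceilings equals the number of dominant regions of $\mathsf{Ish}(G)$ with exactly $c$ ceilings.
   Context: Edges of $G$ are written $ij$ with $i<j$. Regions are connected components of the complement of the union of the hyperplanes. A region is dominant if it is contained in the cone $x_1>x_2>\cdots>x_n$. A ceiling of a region $R$ is a hyperplane of the arrangement, not containing the origin, which is the affine span of a codimension-one face of the closure $\bar R$ and such that $R$ and the origin lie in the same half-space of it. *)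

theory Defs
  imports "HOL-Analysis.Analysis"
begin

text \<open>
  Points of \<open>\<real>\<^sup>n\<close> have type \<open>real ^ 'n\<close>. The map \<open>ix\<close> is meant to be a bijection from
  \<open>{1..n}\<close> onto the index type, so that \<open>x $ ix i\<close> is the coordinate \<open>x\<^sub>i\<close>.
  A simple loopless graph on \<open>[n]\<close> is a set of two-element subsets of \<open>{1..n}\<close>; its edge \<open>ij\<close>
  (with \<open>i < j\<close>) is the set \<open>{i, j}\<close>.
\<close>

definition Shi :: "(nat \<Rightarrow> 'n::finite) \<Rightarrow> nat \<Rightarrow> nat set set \<Rightarrow> (real ^ 'n) set set" where
  "Shi ix n G =
     {{x. x $ ix i - x $ ix j = 0} | i j. 1 \<le> i \<and> i < j \<and> j \<le> n} \<union>
     {{x. x $ ix i - x $ ix j = 1} | i j. i < j \<and> {i, j} \<in> G}"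

definition Ish :: "(nat \<Rightarrow> 'n::finite) \<Rightarrow> nat \<Rightarrow> nat set set \<Rightarrow> (real ^ 'n) set set" where
  "Ish ix n G =
     {{x. x $ ix i - x $ ix j = 0} | i j. 1 \<le> i \<and> i < j \<and> j \<le> n} \<union>
     {{x. x $ ix 1 - x $ ix j = real i} | i j. i < j \<and> {i, j} \<in> G}"

definition regions :: "'a::euclidean_space set set \<Rightarrow> 'a set set" where
  "regions A = components (- \<Union>A)"

definition dominant_regions ::
    "(nat \<Rightarrow> 'n::finite) \<Rightarrow> nat \<Rightarrow> (real ^ 'n) set set \<Rightarrow> (real ^ 'n) set set" where
  "dominant_regions ix n A =
     {R \<in> regions A. R \<subseteq> {x. \<forall>i j. 1 \<le> i \<and> i < j \<and> j \<le> n \<longrightarrow> x $ ix i > x $ ix j}}"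

text \<open>
  As \<open>(a, b)\<close> may be replaced by \<open>(- a, - b)\<close>, asking for the side \<open>a \<bullet> x < b\<close> covers both open
  half-spaces bounded by \<open>H\<close>.
\<close>

definition same_half_space :: "'a::euclidean_space set \<Rightarrow> 'a set \<Rightarrow> 'a \<Rightarrow> bool" where
  "same_half_space H R p \<longleftrightarrow>
     (\<exists>a b. a \<noteq> 0 \<and> H = {x. a \<bullet> x = b} \<and> R \<subseteq> {x. a \<bullet> x < b} \<and> a \<bullet> p < b)"

definition ceilings :: "'a::euclidean_space set set \<Rightarrow> 'a set \<Rightarrow> 'a set set" where
  "ceilings A R =
     {H \<in> A. 0 \<notin> H \<and> (\<exists>F. F facet_of closure R \<and> affine hull F = H) \<and> same_half_space H R 0}"

end

theory Submission
  imports Defs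
begin

text \<open>
  Order the edges by inclusion of the intervals \<open>[i, j]\<close>. On the dominant cone both
  \<open>x\<^sub>i - x\<^sub>j < 1\<close> and \<open>x\<^sub>1 - x\<^sub>j < i\<close> are inherited by smaller edges, so in either arrangement
  the edges whose hyperplane does not separate a given dominant region from the origin form an
  order ideal. Every ideal occurs, and the ceilings are the hyperplanes of its maximal elements:
  removing a maximal element \<open>e\<close> from the ideal \<open>I\<close> leaves an ideal, and a segment between the
  regions of \<open>I\<close> and \<open>I - {e}\<close> crosses the hyperplane of \<open>e\<close> and no other one. Hence both numbers
  count the order ideals with exactly \<open>c\<close> maximal elements.
\<close>

section \<open>Arrangements whose regions in a cone are order ideals\<close>

definition order_ideals :: "('e \<Rightarrow> 'e \<Rightarrow> bool) \<Rightarrow> 'e set \<Rightarrow> 'e set set" where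
  "order_ideals le E = {I. I \<subseteq> E \<and> (\<forall>f\<in>I. \<forall>e\<in>E. le e f \<longrightarrow> e \<in> I)}"

definition maximal_elements :: "('e \<Rightarrow> 'e \<Rightarrow> bool) \<Rightarrow> 'e set \<Rightarrow> 'e set" where
  "maximal_elements le I = {e \<in> I. \<forall>f\<in>I. le e f \<longrightarrow> f = e}"

lemma order_ideals_remove_maximal:
  assumes "I \<in> order_ideals le E" "e \<in> maximal_elements le I"
  shows "I - {e} \<in> order_ideals le E"
  using assms unfolding order_ideals_def maximal_elements_def by blast

text \<open>This is the common core of both arrangements. Vectors in \<open>P\<close> are normals of
  the hyperplanes through the origin that bound the cone, and \<open>b_pos\<close> puts the origin
  strictly below every wall. On the cone, \<open>below_wall_mono\<close> forces the walls lying
  above a point to form an ideal, and \<open>ideal_realized\<close> is the converse.\<close>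

locale ideal_arrangement =
  fixes P :: "'a::euclidean_space set" and E :: "'e set"
    and v :: "'e \<Rightarrow> 'a" and b :: "'e \<Rightarrow> real" and le :: "'e \<Rightarrow> 'e \<Rightarrow> bool"
  assumes finite_P: "finite P" and finite_E: "finite E"
    and P_nonzero: "p \<in> P \<Longrightarrow> p \<noteq> 0"
    and v_nonzero: "e \<in> E \<Longrightarrow> v e \<noteq> 0"
    and b_pos: "e \<in> E \<Longrightarrow> 0 < b e"
    and inj_walls: "inj_on (\<lambda>e. {x. v e \<bullet> x = b e}) E"
    and below_wall_mono: "\<lbrakk>e \<in> E; f \<in> E; le e f; \<forall>p\<in>P. 0 < p \<bullet> x; v f \<bullet> x < b f\<rbrakk> \<Longrightarrow> v e \<bullet> x < b e"
    and ideal_realized: "I \<in> order_ideals le E \<Longrightarrow>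
      \<exists>x. (\<forall>p\<in>P. 0 < p \<bullet> x) \<and> (\<forall>e\<in>I. v e \<bullet> x < b e) \<and> (\<forall>e\<in>E - I. b e < v e \<bullet> x)"
begin

section \<open>Cells of sets of walls and the regions in the cone\<close>

definition open_cone :: "'a set" where
  "open_cone = {x. \<forall>p\<in>P. 0 < p \<bullet> x}"

definition wall :: "'e \<Rightarrow> 'a set" where
  "wall e = {x. v e \<bullet> x = b e}"

definition arr :: "'a set set" where
  "arr = (\<lambda>p. {x. p \<bullet> x = 0}) ` P \<union> wall ` E"

text \<open>As \<open>b e\<close> is positive, \<open>I\<close> lists the walls that do not separate
  the cell from the origin. The cell may be empty for a general \<open>I\<close>.\<close>

definition cell :: "'e set \<Rightarrow> 'a set" where
  "cell I = {x \<in> open_cone. (\<forall>e\<in>I. v e \<bullet> x < b e) \<and> (\<forall>e\<in>E - I. b e < v e \<bullet> x)}"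

lemma cell_eq_Inter:
  "cell I = (\<Inter>p\<in>P. {x. p \<bullet> x > 0}) \<inter> (\<Inter>e\<in>I. {x. v e \<bullet> x < b e}) \<inter> (\<Inter>e\<in>E - I. {x. v e \<bullet> x > b e})"
  by (auto simp: cell_def open_cone_def)

lemma convex_cell: "convex (cell I)"
  unfolding cell_eq_Inter
  by (intro convex_Int convex_INT convex_halfspace_lt convex_halfspace_gt)

lemma open_cell: "I \<subseteq> E \<Longrightarrow> open (cell I)"
  unfolding cell_eq_Inter
  by (intro open_Int open_INT ballI open_halfspace_lt open_halfspace_gt finite_P finite_Diff finite_E)
    (auto intro: finite_subset finite_E)

lemma cell_nonempty_iff:
  assumes "I \<subseteq> E"
  shows "cell I \<noteq> {} \<longleftrightarrow> I \<in> order_ideals le E"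
proof
  assume "cell I \<noteq> {}"
  then obtain x where x: "x \<in> cell I" by blast
  have "e \<in> I" if "f \<in> I" "e \<in> E" "le e f" for e f
  proof (rule ccontr)
    assume "e \<notin> I"
    then have "b e < v e \<bullet> x" using x that by (auto simp: cell_def)
    moreover have "v e \<bullet> x < b e"
      using below_wall_mono[of e f x] that x assms by (auto simp: cell_def open_cone_def)
    ultimately show False by simp
  qed
  then show "I \<in> order_ideals le E" using assms by (auto simp: order_ideals_def)
next
  assume "I \<in> order_ideals le E"
  from ideal_realized[OF this] show "cell I \<noteq> {}"
    by (auto simp: cell_def open_cone_def)
qed

lemma cell_nonempty: "I \<in> order_ideals le E \<Longrightarrow> cell I \<noteq> {}"
  using cell_nonempty_iff by (simp add: order_ideals_def)

lemma cell_determines_ideal: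
  assumes "x \<in> cell I" "I \<subseteq> E"
  shows "I = {e \<in> E. v e \<bullet> x < b e}"
proof (rule set_eqI)
  fix e
  have "e \<in> I \<longrightarrow> v e \<bullet> x < b e" "e \<in> E - I \<longrightarrow> b e < v e \<bullet> x"
    using assms(1) by (auto simp: cell_def)
  then show "e \<in> I \<longleftrightarrow> e \<in> {e \<in> E. v e \<bullet> x < b e}"
    using assms(2) by auto
qed

lemma cell_subset_complement: "cell I \<subseteq> - \<Union>arr"
proof
  fix x assume x: "x \<in> cell I"
  have "p \<bullet> x \<noteq> 0" if "p \<in> P" for p using x that by (auto simp: cell_def open_cone_def)
  moreover have "v e \<bullet> x < b e \<or> b e < v e \<bullet> x" if "e \<in> E" for e
    using x that by (auto simp: cell_def)
  ultimately show "x \<in> - \<Union>arr" by (fastforce simp: arr_def wall_def)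
qed

text \<open>If some linear functional were on the wrong side of its bound at a point of
  \<open>R\<close>, the intermediate value theorem on the connected set \<open>R\<close> would give
  a point of \<open>R\<close> on a hyperplane of the arrangement.\<close>

lemma connected_subset_cell:
  assumes "connected R" "R \<subseteq> - \<Union>arr" "R \<inter> cell I \<noteq> {}" "I \<subseteq> E"
  shows "R \<subseteq> cell I"
proof -
  obtain x where x: "x \<in> R" "x \<in> cell I" using assms by blast
  have walls: "v e \<bullet> y \<noteq> b e" if "e \<in> E" "y \<in> R" for e y
    using that assms(2) by (auto simp: arr_def wall_def)
  have P: "p \<bullet> y \<noteq> 0" if "p \<in> P" "y \<in> R" for p y
    using that assms(2) by (auto simp: arr_def)
  show ?thesis
  proof
    fix y assume y: "y \<in> R"
    have "0 < p \<bullet> y" if "p \<in> P" for p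
    proof (rule ccontr)
      assume "\<not> 0 < p \<bullet> y"
      moreover have "0 < p \<bullet> x" using x that by (auto simp: cell_def open_cone_def)
      ultimately show False
        using connected_ivt_hyperplane[OF assms(1) y x(1), of p 0] P that by fastforce
    qed
    moreover have "v e \<bullet> y < b e" if "e \<in> I" for e
    proof (rule ccontr)
      assume "\<not> v e \<bullet> y < b e"
      moreover have "v e \<bullet> x < b e" using x that by (auto simp: cell_def)
      ultimately show False
        using connected_ivt_hyperplane[OF assms(1) x(1) y, of "v e" "b e"] walls that assms(4) by fastforce
    qed
    moreover have "b e < v e \<bullet> y" if "e \<in> E - I" for e
    proof (rule ccontr)
      assume "\<not> b e < v e \<bullet> y"
      moreover have "b e < v e \<bullet> x" using x that by (auto simp: cell_def)
      ultimately show False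
        using connected_ivt_hyperplane[OF assms(1) y x(1), of "v e" "b e"] walls that by fastforce
    qed
    ultimately show "y \<in> cell I" by (auto simp: cell_def open_cone_def)
  qed
qed

text \<open>The ideal of a region is read off at any one of its points. Connectedness of the region
  puts it inside the cell, and maximality of components puts the convex cell inside the
  region.\<close>

lemma regions_in_cone: "{R \<in> regions arr. R \<subseteq> open_cone} = cell ` order_ideals le E"
proof (intro equalityI subsetI)
  fix R assume "R \<in> {R \<in> regions arr. R \<subseteq> open_cone}"
  then have R: "R \<in> components (- \<Union>arr)" "R \<subseteq> open_cone" by (auto simp: regions_def)
  then obtain x where x: "x \<in> R" using in_components_nonempty by blast
  define I where "I = {e \<in> E. v e \<bullet> x < b e}"
  have IE: "I \<subseteq> E" by (auto simp: I_def)
  have sub: "R \<subseteq> - \<Union>arr" using R(1) in_components_subset by blast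
  have xI: "x \<in> cell I"
    using x R(2) sub by (force simp: cell_def I_def arr_def wall_def)
  have "R \<subseteq> cell I"
    using connected_subset_cell[OF in_components_connected[OF R(1)] sub _ IE] x xI by blast
  moreover have "cell I \<subseteq> R"
    using components_maximal[OF R(1) convex_connected[OF convex_cell] cell_subset_complement, of I] x xI
    by blast
  ultimately show "R \<in> cell ` order_ideals le E"
    using cell_nonempty_iff[OF IE] xI by blast
next
  fix R assume "R \<in> cell ` order_ideals le E"
  then obtain I where I: "I \<in> order_ideals le E" "R = cell I" by blast
  then have IE: "I \<subseteq> E" by (auto simp: order_ideals_def)
  have ne: "cell I \<noteq> {}" using cell_nonempty[OF I(1)] .
  have "cell I \<in> components (- \<Union>arr)"
    unfolding in_components_maximal
    using ne cell_subset_complement convex_connected[OF convex_cell] connected_subset_cell[OF _ _ _ IE]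
    by (metis inf.absorb_iff2 subset_antisym)
  moreover have "cell I \<subseteq> open_cone" by (auto simp: cell_def)
  ultimately show "R \<in> {R \<in> regions arr. R \<subseteq> open_cone}" using I by (auto simp: regions_def)
qed

lemma inj_on_cell: "inj_on cell (order_ideals le E)"
proof (rule inj_onI)
  fix I J assume IJ: "I \<in> order_ideals le E" "J \<in> order_ideals le E" "cell I = cell J"
  then have sub: "I \<subseteq> E" "J \<subseteq> E" by (auto simp: order_ideals_def)
  obtain x where "x \<in> cell I" using cell_nonempty[OF IJ(1)] by blast
  then show "I = J"
    using cell_determines_ideal[of x I] cell_determines_ideal[of x J] sub IJ(3) by simp
qed

section \<open>Ceilings of a cell and maximal elements\<close>

text \<open>The definition of \<open>same_half_space\<close> allows any equation
  \<open>a \<bullet> x = c\<close> of the wall, so the case \<open>e \<notin> I\<close> must refute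
  all of them: the segment from the origin to a point of the cell crosses the wall, which is
  impossible if both ends satisfy \<open>a \<bullet> x < c\<close>.\<close>

lemma same_half_space_wall_iff:
  assumes I: "I \<in> order_ideals le E" and e: "e \<in> E"
  shows "same_half_space (wall e) (cell I) 0 \<longleftrightarrow> e \<in> I"
proof
  assume "e \<in> I"
  then show "same_half_space (wall e) (cell I) 0"
    unfolding same_half_space_def wall_def
    using e v_nonzero b_pos
    by (intro exI[of _ "v e"] exI[of _ "b e"]) (auto simp: cell_def)
next
  assume "same_half_space (wall e) (cell I) 0"
  then obtain a c where ac: "wall e = {x. a \<bullet> x = c}" "cell I \<subseteq> {x. a \<bullet> x < c}" "0 < c"
    by (auto simp: same_half_space_def)
  show "e \<in> I"
  proof (rule ccontr)
    assume "e \<notin> I"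
    obtain x where x: "x \<in> cell I" using cell_nonempty[OF I] by blast
    have vx: "b e < v e \<bullet> x" using x e \<open>e \<notin> I\<close> by (auto simp: cell_def)
    have be: "0 < b e" using e b_pos by blast
    \<comment> \<open>The point \<open>t *\<^sub>R x\<close> is where the segment from the origin to
      \<open>x\<close> meets the wall.\<close>
    define t where "t = b e / (v e \<bullet> x)"
    have t: "0 < t" "t < 1" using vx be by (auto simp: t_def)
    have "t *\<^sub>R x \<in> wall e" using vx be by (auto simp: wall_def t_def)
    then have "t * (a \<bullet> x) = c" using ac by auto
    moreover have "a \<bullet> x < c" using ac x by auto
    ultimately have "c < t * c" using t by (metis mult_strict_left_mono)
    then show False using t ac(3) by simp
  qed
qed

lemma facet_of_maximal:
  assumes I: "I \<in> order_ideals le E" and e: "e \<in> maximal_elements le I"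
  shows "\<exists>F. F facet_of closure (cell I) \<and> affine hull F = wall e"
proof -
  have IE: "I \<subseteq> E" and eI: "e \<in> I" and eE: "e \<in> E"
    using I e by (auto simp: order_ideals_def maximal_elements_def)
  obtain p where p: "p \<in> cell I" using cell_nonempty[OF I] by blast
  obtain q where q: "q \<in> cell (I - {e})"
    using cell_nonempty[OF order_ideals_remove_maximal[OF I e]] by blast
  \<comment> \<open>These are the inequalities shared by the cells of \<open>I\<close> and
    \<open>I - {e}\<close>, so \<open>U\<close> contains both \<open>p\<close> and \<open>q\<close>,
    on opposite sides of the wall of \<open>e\<close>. By convexity it meets that wall.\<close>
  define U where "U = (\<Inter>p\<in>P. {x. p \<bullet> x > 0}) \<inter> (\<Inter>f\<in>I - {e}. {x. v f \<bullet> x < b f})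
    \<inter> (\<Inter>f\<in>E - I. {x. v f \<bullet> x > b f})"
  have cell_U: "cell I = U \<inter> {x. v e \<bullet> x < b e}"
    using eI by (auto simp: cell_eq_Inter U_def)
  have "convex U" unfolding U_def
    by (intro convex_Int convex_INT convex_halfspace_lt convex_halfspace_gt)
  have "open U" unfolding U_def
    by (intro open_Int open_INT ballI open_halfspace_lt open_halfspace_gt finite_P finite_Diff finite_E)
      (auto intro: finite_subset[OF IE] finite_E)
  have pU: "p \<in> U" and pe: "v e \<bullet> p < b e" using p cell_U by auto
  have qU: "q \<in> U" and qe: "b e < v e \<bullet> q" using q eI eE by (auto simp: cell_eq_Inter U_def)
  obtain w where w: "w \<in> U" "v e \<bullet> w = b e"
    using connected_ivt_hyperplane[OF convex_connected[OF \<open>convex U\<close>] pU qU, of "v e" "b e"] pe qe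
    by force
  define F where "F = closure (cell I) \<inter> {x. v e \<bullet> x = b e}"
  have "cell I \<subseteq> {x. v e \<bullet> x \<le> b e}" using cell_U by auto
  then have le: "closure (cell I) \<subseteq> {x. v e \<bullet> x \<le> b e}"
    by (rule closure_minimal) (rule closed_halfspace_le)
  have "F face_of closure (cell I)"
    unfolding F_def using le
    by (intro face_of_Int_supporting_hyperplane_le convex_closure convex_cell) auto
  \<comment> \<open>Moving from such a point towards \<open>p\<close> stays in \<open>U\<close> and
    drops strictly below the wall at once, so the point is a limit of points of the cell.\<close>
  have sub: "wall e \<inter> U \<subseteq> F"
  proof
    fix x assume x: "x \<in> wall e \<inter> U"
    have "open_segment x p \<subseteq> cell I"
    proof
      fix y assume y: "y \<in> open_segment x p"
      then have "y \<in> U"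
        using convex_contains_open_segment[of U] \<open>convex U\<close> x pU by blast
      obtain t where t: "0 < t" "t < 1" "y = (1 - t) *\<^sub>R x + t *\<^sub>R p"
        using y by (auto simp: in_segment)
      have "v e \<bullet> y = (1 - t) * b e + t * (v e \<bullet> p)"
        using x t by (simp add: inner_add_right wall_def)
      also have "\<dots> < (1 - t) * b e + t * b e" using pe t by simp
      finally have "v e \<bullet> y < b e" by (simp add: algebra_simps)
      then show "y \<in> cell I" using \<open>y \<in> U\<close> cell_U by blast
    qed
    moreover have "x \<noteq> p" using x pe by (auto simp: wall_def)
    then have "x \<in> closure (open_segment x p)" by simp
    ultimately have "x \<in> closure (cell I)" using closure_mono by blast
    then show "x \<in> F" using x by (auto simp: F_def wall_def)
  qed
  have aff: "affine (wall e)" unfolding wall_def by (rule affine_hyperplane)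
  have "affine hull F = wall e"
  proof
    show "affine hull F \<subseteq> wall e"
      using aff by (intro hull_minimal) (auto simp: F_def wall_def)
    have "wall e \<inter> U \<noteq> {}" using w by (auto simp: wall_def)
    \<comment> \<open>A nonempty relatively open part of a hyperplane spans it.\<close>
    from affine_hull_affine_Int_open[OF aff \<open>open U\<close> this]
    have "affine hull (wall e \<inter> U) = wall e" using aff by (simp only: affine_hull_eq)
    then show "wall e \<subseteq> affine hull F" using sub hull_mono by metis
  qed
  moreover have "aff_dim (closure (cell I)) = DIM('a)"
    using aff_dim_open[OF open_cell[OF IE] cell_nonempty[OF I]]
      aff_dim_affine_hull2[OF closure_same_affine_hull, of "cell I"] by simp
  moreover have "aff_dim F = int DIM('a) - 1"
    using aff_dim_affine_hull[of F] aff_dim_hyperplane[OF v_nonzero[OF eE], of "b e"]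
    by (simp add: \<open>affine hull F = wall e\<close> wall_def)
  moreover have "F \<noteq> {}" using sub w by (auto simp: wall_def)
  ultimately show ?thesis using \<open>F face_of closure (cell I)\<close> by (auto simp: facet_of_def)
qed

text \<open>At a relative interior point \<open>w\<close> of the facet, the wall of \<open>e\<close>
  is the only tight one. Pushing \<open>w\<close> across it violates the inequality of
  \<open>e\<close> while keeping those of all other \<open>f \<in> I\<close>, so by
  \<open>below_wall_mono\<close> no such \<open>f\<close> lies above \<open>e\<close>.\<close>

lemma maximal_of_facet:
  assumes I: "I \<in> order_ideals le E" and e: "e \<in> I"
    and F: "F facet_of closure (cell I)" "affine hull F = wall e"
  shows "e \<in> maximal_elements le I"
proof -
  have IE: "I \<subseteq> E" and eE: "e \<in> E" using I e by (auto simp: order_ideals_def)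
  have "convex F" using F(1) facet_of_imp_face_of face_of_imp_convex by blast
  moreover have "F \<noteq> {}" using F(1) by (auto simp: facet_of_def)
  ultimately obtain w where w: "w \<in> rel_interior F"
    using rel_interior_eq_empty by blast
  then have wF: "w \<in> F" using rel_interior_subset by blast
  then have we: "w \<in> wall e" using F(2) hull_subset by fastforce
  have Fsub: "F \<subseteq> closure (cell I)" using F(1) facet_of_imp_subset by blast
  have weak: "F \<subseteq> {x. a \<bullet> x \<le> c}" if "cell I \<subseteq> {x. a \<bullet> x \<le> c}" for a c
    using Fsub closure_minimal[OF that closed_halfspace_le] by blast
  \<comment> \<open>An inequality that is tight in the relative interior of \<open>F\<close> is tight on the affine hull of
    \<open>F\<close>, so its boundary hyperplane is the wall of \<open>e\<close>.\<close>
  have strict: "a \<bullet> w < c" if a: "a \<noteq> 0" and cell: "cell I \<subseteq> {x. a \<bullet> x \<le> c}"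
    and neq: "{x. a \<bullet> x = c} \<noteq> wall e" for a c
  proof (rule ccontr)
    assume "\<not> a \<bullet> w < c"
    with weak[OF cell] wF have wc: "a \<bullet> w = c" by force
    have "F \<subseteq> {x. a \<bullet> x = c}"
    proof
      fix y assume y: "y \<in> F"
      \<comment> \<open>The segment from \<open>y\<close> to \<open>w\<close> can be prolonged
        beyond \<open>w\<close> inside \<open>F\<close>. If the inequality were strict at
        \<open>y\<close> and tight at \<open>w\<close>, it would fail at the prolonged end.\<close>
      obtain m where m: "1 < m" "(1 - m) *\<^sub>R y + m *\<^sub>R w \<in> F"
        using w y convex_rel_interior_iff[OF \<open>convex F\<close> \<open>F \<noteq> {}\<close>] by blast
      have "a \<bullet> ((1 - m) *\<^sub>R y + m *\<^sub>R w) \<le> c" using m weak[OF cell] by blast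
      then have "(1 - m) * (a \<bullet> y) + m * c \<le> c" by (simp add: inner_add_right wc)
      then have "(m - 1) * c \<le> (m - 1) * (a \<bullet> y)" by (simp add: algebra_simps)
      then have "c \<le> a \<bullet> y" using m by simp
      then show "y \<in> {x. a \<bullet> x = c}" using weak[OF cell] y by force
    qed
    then have "wall e \<subseteq> {x. a \<bullet> x = c}"
      using F(2) hull_minimal[of F "{x. a \<bullet> x = c}" affine] affine_hyperplane by metis
    then have "wall e = {x. a \<bullet> x = c}"
      using aff_dim_hyperplane[OF a, of c] aff_dim_hyperplane[OF v_nonzero[OF eE], of "b e"] we
      by (intro affine_dim_equal) (auto simp: wall_def affine_hyperplane)
    then show False using neq by blast
  qed
  have wP: "0 < p \<bullet> w" if "p \<in> P" for p
  proof -
    \<comment> \<open>The origin tells the hyperplanes bounding the cone apart from the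
      walls.\<close>
    have "0 \<in> {x. - p \<bullet> x = 0}" "0 \<notin> wall e" using b_pos[OF eE] by (auto simp: wall_def)
    then have "{x. - p \<bullet> x = 0} \<noteq> wall e" by blast
    then show ?thesis
      using strict[of "- p" 0] P_nonzero[OF that] that by (force simp: cell_def open_cone_def)
  qed
  have wI: "v f \<bullet> w < b f" if "f \<in> I" "f \<noteq> e" for f
  proof -
    have "f \<in> E" using that IE by blast
    then have "{x. v f \<bullet> x = b f} \<noteq> wall e"
      using inj_onD[OF inj_walls] that eE unfolding wall_def by blast
    then show ?thesis
      using strict[of "v f" "b f"] v_nonzero[OF \<open>f \<in> E\<close>] that by (force simp: cell_def)
  qed
  define U where "U = (\<Inter>p\<in>P. {x. p \<bullet> x > 0}) \<inter> (\<Inter>f\<in>I - {e}. {x. v f \<bullet> x < b f})"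
  have "open U" unfolding U_def
    by (intro open_Int open_INT ballI open_halfspace_lt open_halfspace_gt finite_P finite_Diff)
      (auto intro: finite_subset[OF IE] finite_E)
  moreover have "w \<in> U" using wP wI by (auto simp: U_def)
  ultimately obtain r where r: "0 < r" "cball w r \<subseteq> U" using open_contains_cball by blast
  \<comment> \<open>A step of length \<open>r\<close> along the normal stays in the ball inside
    \<open>U\<close> and ends beyond the wall of \<open>e\<close>.\<close>
  define x where "x = w + (r / norm (v e)) *\<^sub>R v e"
  have ve: "v e \<noteq> 0" using v_nonzero[OF eE] .
  have "x \<in> U" using r ve by (intro subsetD[OF r(2)]) (auto simp: x_def dist_norm)
  have "v e \<bullet> w = b e" using we by (simp add: wall_def)
  moreover have "0 < (r / norm (v e)) * (v e \<bullet> v e)" using r ve by simp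
  ultimately have xe: "b e < v e \<bullet> x" by (simp add: x_def inner_add_right)
  have "f = e" if f: "f \<in> I" "le e f" for f
  proof (rule ccontr)
    assume "f \<noteq> e"
    then have "v f \<bullet> x < b f" "\<forall>p\<in>P. 0 < p \<bullet> x" using \<open>x \<in> U\<close> f by (auto simp: U_def)
    then show False using below_wall_mono[OF eE _ f(2)] f IE xe by fastforce
  qed
  then show ?thesis using e by (auto simp: maximal_elements_def)
qed

lemma ceilings_cell:
  assumes I: "I \<in> order_ideals le E"
  shows "ceilings arr (cell I) = wall ` maximal_elements le I"
proof (intro equalityI subsetI)
  fix H assume H: "H \<in> ceilings arr (cell I)"
  then have "0 \<notin> H" "H \<in> arr" by (auto simp: ceilings_def)
  then obtain e where e: "e \<in> E" "H = wall e" by (auto simp: arr_def)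
  then have "e \<in> I" using H same_half_space_wall_iff[OF I] by (auto simp: ceilings_def)
  then have "e \<in> maximal_elements le I"
    using H e maximal_of_facet[OF I] by (auto simp: ceilings_def)
  then show "H \<in> wall ` maximal_elements le I" using e by blast
next
  fix H assume "H \<in> wall ` maximal_elements le I"
  then obtain e where e: "e \<in> maximal_elements le I" "H = wall e" by blast
  then have "e \<in> I" "e \<in> E" using I by (auto simp: maximal_elements_def order_ideals_def)
  moreover have "0 \<notin> wall e" using b_pos[OF \<open>e \<in> E\<close>] by (auto simp: wall_def)
  ultimately show "H \<in> ceilings arr (cell I)"
    using facet_of_maximal[OF I e(1)] same_half_space_wall_iff[OF I] e
    by (auto simp: ceilings_def arr_def)
qed

lemma card_ceilings_cell:
  assumes I: "I \<in> order_ideals le E"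
  shows "card (ceilings arr (cell I)) = card (maximal_elements le I)"
proof -
  have "maximal_elements le I \<subseteq> E" using I by (auto simp: maximal_elements_def order_ideals_def)
  then have "inj_on wall (maximal_elements le I)"
    using inj_on_subset[OF inj_walls] by (simp add: wall_def[abs_def])
  then show ?thesis by (simp add: ceilings_cell[OF I] card_image)
qed

text \<open>The right-hand side depends only on \<open>E\<close> and \<open>le\<close>, so
  arrangements over the same ordered set of edges have equal counts.\<close>

theorem card_regions_by_ceilings:
  "card {R \<in> regions arr. R \<subseteq> open_cone \<and> int (card (ceilings arr R)) = c} =
   card {I \<in> order_ideals le E. int (card (maximal_elements le I)) = c}"
proof -
  have "{R \<in> regions arr. R \<subseteq> open_cone \<and> int (card (ceilings arr R)) = c} =
      {R \<in> {R \<in> regions arr. R \<subseteq> open_cone}. int (card (ceilings arr R)) = c}" by blast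
  also have "\<dots> = cell ` {I \<in> order_ideals le E. int (card (maximal_elements le I)) = c}"
    unfolding regions_in_cone using card_ceilings_cell by auto
  finally show ?thesis
    using card_image[OF inj_on_subset[OF inj_on_cell]] by (metis (no_types, lifting) mem_Collect_eq subsetI)
qed

end

section \<open>The Shi and Ish arrangements\<close>

definition edge_pairs :: "nat set set \<Rightarrow> (nat \<times> nat) set" where
  "edge_pairs G = {(i, j). i < j \<and> {i, j} \<in> G}"

definition nested :: "nat \<times> nat \<Rightarrow> nat \<times> nat \<Rightarrow> bool" where
  "nested e f \<longleftrightarrow> fst f \<le> fst e \<and> snd e \<le> snd f"

section \<open>Points realizing a prescribed ideal\<close>

lemma finite_sets_separated_by_real:
  fixes L U :: "real set"
  assumes "finite L" "finite U" "\<And>l u. l \<in> L \<Longrightarrow> u \<in> U \<Longrightarrow> l < u"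
  shows "\<exists>r. (\<forall>l\<in>L. l < r) \<and> (\<forall>u\<in>U. r < u)"
proof (cases "L = {} \<or> U = {}")
  case True
  then show ?thesis
  proof
    assume "L = {}"
    \<comment> \<open>Inserting 0 keeps the minimum meaningful when \<open>U\<close> is empty
      too.\<close>
    have "Min (insert 0 U) - 1 < u" if "u \<in> U" for u
    proof -
      have "Min (insert 0 U) \<le> u" using assms(2) that by (intro Min_le) auto
      then show ?thesis by linarith
    qed
    then show ?thesis using \<open>L = {}\<close> by (intro exI[of _ "Min (insert 0 U) - 1"]) simp
  next
    assume "U = {}"
    have "l < Max (insert 0 L) + 1" if "l \<in> L" for l
    proof -
      have "l \<le> Max (insert 0 L)" using assms(1) that by (intro Max_ge) auto
      then show ?thesis by linarith
    qed
    then show ?thesis using \<open>U = {}\<close> by (intro exI[of _ "Max (insert 0 L) + 1"]) simp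
  qed
next
  case False
  then have "Max L < Min U" using assms by auto
  then obtain r where "Max L < r" "r < Min U" using dense by blast
  then show ?thesis using False assms(1,2) by auto
qed

text \<open>This is a representation of a unit interval order: \<open>Q\<close> prescribes which
  pairs are closer than 1. Points are added from left to right; heredity of \<open>Q\<close> makes
  the lower and upper bounds on each new point compatible.\<close>

lemma unit_interval_representation:
  fixes Q :: "nat \<Rightarrow> nat \<Rightarrow> bool"
  assumes Q: "\<And>i j i' j'. \<lbrakk>Q i j; i \<le> i'; i' < j'; j' \<le> j\<rbrakk> \<Longrightarrow> Q i' j'"
  shows "\<exists>z :: nat \<Rightarrow> real. \<forall>i j. i < j \<and> j \<le> m \<longrightarrow>
    z i < z j \<and> (if Q i j then z j < z i + 1 else z i + 1 < z j)"
proof (induction m)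
  case 0
  then show ?case by auto
next
  case (Suc m)
  then obtain z :: "nat \<Rightarrow> real" where
    mono: "\<And>i j. i < j \<Longrightarrow> j \<le> m \<Longrightarrow> z i < z j" and
    near: "\<And>i j. i < j \<Longrightarrow> j \<le> m \<Longrightarrow> Q i j \<Longrightarrow> z j < z i + 1" and
    far: "\<And>i j. i < j \<Longrightarrow> j \<le> m \<Longrightarrow> \<not> Q i j \<Longrightarrow> z i + 1 < z j"
    by metis
  \<comment> \<open>\<open>L\<close> and \<open>U\<close> collect the lower and upper bounds that
    the new point has to respect.\<close>
  define L where "L = z ` {..m} \<union> (\<lambda>i. z i + 1) ` {i \<in> {..m}. \<not> Q i (Suc m)}"
  define U where "U = (\<lambda>i. z i + 1) ` {i \<in> {..m}. Q i (Suc m)}"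
  have "l < u" if l: "l \<in> L" and u: "u \<in> U" for l u
  proof -
    obtain k where k: "k \<le> m" "Q k (Suc m)" "u = z k + 1" using u by (auto simp: U_def)
    from l consider i where "i \<le> m" "l = z i" | i where "i \<le> m" "\<not> Q i (Suc m)" "l = z i + 1"
      by (auto simp: L_def)
    then show ?thesis
    proof cases
      case 1
      show ?thesis
      proof (cases "k < i")
        case True
        then have "Q k i" using Q[OF k(2)] 1 by auto
        then show ?thesis using near[OF True] 1 k by auto
      next
        case False
        then have "z i \<le> z k" using mono[of i k] k by (cases "i = k") auto
        then show ?thesis using 1 k by auto
      qed
    next
      case 2
      \<comment> \<open>Otherwise \<open>k \<le> i\<close>, and \<open>Q i (Suc m)\<close> would be
        inherited from \<open>Q k (Suc m)\<close>.\<close>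
      then have "i < k" using Q[OF k(2), of i "Suc m"] by force
      then show ?thesis using mono[of i k] 2 k by auto
    qed
  qed
  then obtain r where r: "\<forall>l\<in>L. l < r" "\<forall>u\<in>U. r < u"
    using finite_sets_separated_by_real[of L U] by (auto simp: L_def U_def)
  have "i < j \<and> j \<le> Suc m \<longrightarrow> (z(Suc m := r)) i < (z(Suc m := r)) j \<and>
      (if Q i j then (z(Suc m := r)) j < (z(Suc m := r)) i + 1
       else (z(Suc m := r)) i + 1 < (z(Suc m := r)) j)" for i j
    using mono[of i j] near[of i j] far[of i j] r
    by (cases "j = Suc m") (auto simp: L_def U_def)
  then show ?case by blast
qed

lemma Shi_ideal_realized:
  assumes "I \<in> order_ideals nested E"
  shows "\<exists>z :: nat \<Rightarrow> real. (\<forall>i j. i < j \<and> j \<le> n \<longrightarrow> z i < z j) \<and>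
    (\<forall>(i, j)\<in>{(i, j) \<in> I. i < j \<and> j \<le> n}. z j - z i < 1) \<and>
    (\<forall>(i, j)\<in>{(i, j) \<in> E - I. i < j \<and> j \<le> n}. 1 < z j - z i)"
proof -
  \<comment> \<open>\<open>Q\<close> extends \<open>I\<close> to all intervals contained in one of
    its members, which makes it hereditary. Since \<open>I\<close> is an ideal, no pair of
    \<open>E - I\<close> is added.\<close>
  define Q where "Q i j \<longleftrightarrow> (\<exists>k l. (k, l) \<in> I \<and> k \<le> i \<and> j \<le> l)" for i j
  have "\<exists>z :: nat \<Rightarrow> real. \<forall>i j. i < j \<and> j \<le> n \<longrightarrow>
      z i < z j \<and> (if Q i j then z j < z i + 1 else z i + 1 < z j)"
    by (rule unit_interval_representation) (unfold Q_def, meson le_trans)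
  then obtain z :: "nat \<Rightarrow> real" where z: "\<And>i j. i < j \<Longrightarrow> j \<le> n \<Longrightarrow>
      z i < z j \<and> (if Q i j then z j < z i + 1 else z i + 1 < z j)" by blast
  have "Q i j" if "(i, j) \<in> I" for i j using that by (auto simp: Q_def)
  moreover have "\<not> Q i j" if "(i, j) \<in> E - I" for i j
    using that assms by (fastforce simp: Q_def order_ideals_def nested_def)
  ultimately show ?thesis using z by (intro exI[of _ z]) fastforce
qed

text \<open>Here \<open>y j\<close> stands for \<open>x\<^sub>1 - x\<^sub>j\<close>. Its integer
  part is the largest bound \<open>i\<close> that must be exceeded, coming from some
  \<open>(i, k) \<in> E - I\<close> with \<open>k \<le> j\<close>; a small increasing fraction makes
  all inequalities strict.\<close>

lemma Ish_ideal_realized: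
  assumes I: "I \<in> order_ideals nested E" and E: "E \<subseteq> {(i, j). 1 \<le> i \<and> i < j \<and> j \<le> n}"
  shows "\<exists>y :: nat \<Rightarrow> real. y 1 = 0 \<and> (\<forall>i j. 1 \<le> i \<and> i < j \<and> j \<le> n \<longrightarrow> y i < y j) \<and>
    (\<forall>(i, j)\<in>I. y j < real i) \<and> (\<forall>(i, j)\<in>E - I. real i < y j)"
proof -
  \<comment> \<open>The element 0 is the default when nothing has to be exceeded. Admitting all
    \<open>k \<le> j\<close> makes \<open>Max (S j)\<close> weakly increasing in
    \<open>j\<close>.\<close>
  define S where "S j = insert 0 {i. \<exists>k\<le>j. (i, k) \<in> E - I}" for j
  have "S j \<subseteq> {..n}" for j using E by (fastforce simp: S_def)
  then have fin: "finite (S j)" for j using finite_subset by blast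
  define y where "y j = real (Max (S j)) + (real j - 1) / real n" for j
  have "S 1 = {0}" using E by (fastforce simp: S_def)
  then have "y 1 = 0" by (simp add: y_def)
  moreover have "y i < y j" if "1 \<le> i" "i < j" "j \<le> n" for i j
  proof -
    have "Max (S i) \<le> Max (S j)"
      using that fin by (intro Max_mono) (fastforce simp: S_def)+
    moreover have "(real i - 1) / real n < (real j - 1) / real n"
      using that by (intro divide_strict_right_mono) auto
    ultimately show ?thesis by (simp add: y_def)
  qed
  moreover have "y j < real i" if ij: "(i, j) \<in> I" for i j
  proof -
    have "(i, j) \<in> E" using ij I by (auto simp: order_ideals_def)
    then have b: "1 \<le> i" "i < j" "j \<le> n" using E by auto
    have "s < i" if s: "s \<in> S j" for s
    proof (cases "s = 0")
      case False
      then obtain k where "k \<le> j" "(s, k) \<in> E - I" using s by (auto simp: S_def)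
      \<comment> \<open>If \<open>i \<le> s\<close>, then \<open>(s, k)\<close> would be nested in
        \<open>(i, j)\<close> and hence lie in \<open>I\<close>.\<close>
      then show ?thesis using ij I by (fastforce simp: order_ideals_def nested_def)
    qed (use b in auto)
    then have "Max (S j) < i" using fin by (subst Max_less_iff) (auto simp: S_def)
    then have "real (Max (S j)) + 1 \<le> real i" by linarith
    moreover have "(real j - 1) / real n < 1" using b by simp
    ultimately show ?thesis by (simp add: y_def)
  qed
  moreover have "real i < y j" if ij: "(i, j) \<in> E - I" for i j
  proof -
    have b: "1 \<le> i" "i < j" "j \<le> n" using ij E by auto
    have "i \<le> Max (S j)" using ij fin by (intro Max_ge) (auto simp: S_def)
    \<comment> \<open>Positive because \<open>1 \<le> i < j\<close> gives
      \<open>j \<ge> 2\<close>.\<close>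
    moreover have "0 < (real j - 1) / real n" using b by simp
    ultimately show ?thesis by (simp add: y_def)
  qed
  ultimately show ?thesis by (intro exI[of _ y]) auto
qed

lemma edge_pairs_bounds:
  assumes "G \<subseteq> {e. e \<subseteq> {1..n} \<and> card e = 2}"
  shows "edge_pairs G \<subseteq> {(i, j). 1 \<le> i \<and> i < j \<and> j \<le> n}"
  using assms by (fastforce simp: edge_pairs_def)

section \<open>Normals of the hyperplanes bounding the dominant cone\<close>

definition braid_normals :: "(nat \<Rightarrow> 'n::finite) \<Rightarrow> nat \<Rightarrow> (real ^ 'n) set" where
  "braid_normals ix n = {axis (ix i) 1 - axis (ix j) 1 | i j. 1 \<le> i \<and> i < j \<and> j \<le> n}"

lemma inner_axis_diff: "(axis k 1 - axis l 1) \<bullet> x = x $ k - x $ l" for x :: "real ^ 'n"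
  by (simp add: inner_diff_left inner_axis')

lemma braid_normals_pos_iff:
  "(\<forall>p\<in>braid_normals ix n. 0 < p \<bullet> x) \<longleftrightarrow> (\<forall>i j. 1 \<le> i \<and> i < j \<and> j \<le> n \<longrightarrow> x $ ix i > x $ ix j)"
  by (force simp: braid_normals_def inner_axis_diff)

lemma finite_braid_normals: "finite (braid_normals ix n)"
proof (rule finite_subset)
  show "braid_normals ix n \<subseteq> (\<lambda>(i, j). axis (ix i) 1 - axis (ix j) 1) ` ({..n} \<times> {..n})"
    by (force simp: braid_normals_def)
qed simp

lemma braid_hyperplanes:
  fixes ix :: "nat \<Rightarrow> 'n::finite"
  shows "(\<lambda>p. {x. p \<bullet> x = 0}) ` braid_normals ix n =
   {{x. x $ ix i - x $ ix j = 0} | i j. 1 \<le> i \<and> i < j \<and> j \<le> n}"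
proof (intro equalityI subsetI)
  fix H :: "(real ^ 'n) set"
  assume "H \<in> (\<lambda>p. {x. p \<bullet> x = 0}) ` braid_normals ix n"
  then obtain i j where "1 \<le> i \<and> i < j \<and> j \<le> n" "H = {x. (axis (ix i) 1 - axis (ix j) 1) \<bullet> x = 0}"
    by (auto simp: braid_normals_def)
  then show "H \<in> {{x. x $ ix i - x $ ix j = 0} | i j. 1 \<le> i \<and> i < j \<and> j \<le> n}"
    unfolding inner_axis_diff by blast
next
  fix H :: "(real ^ 'n) set"
  assume "H \<in> {{x. x $ ix i - x $ ix j = 0} | i j. 1 \<le> i \<and> i < j \<and> j \<le> n}"
  then obtain i j where ij: "1 \<le> i \<and> i < j \<and> j \<le> n" "H = {x. x $ ix i - x $ ix j = 0}"
    by blast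
  show "H \<in> (\<lambda>p. {x. p \<bullet> x = 0}) ` braid_normals ix n"
  proof (rule image_eqI)
    show "H = {x. (axis (ix i) 1 - axis (ix j) 1) \<bullet> x = 0}" by (simp add: ij(2) inner_axis_diff)
    show "axis (ix i) 1 - axis (ix j) 1 \<in> braid_normals ix n" using ij(1) by (auto simp: braid_normals_def)
  qed
qed

section \<open>Both arrangements as instances of the locale\<close>

context
  fixes n :: nat and ix :: "nat \<Rightarrow> 'n::finite" and G :: "nat set set"
  assumes ix: "bij_betw ix {1..n} (UNIV :: 'n set)"
    and G: "G \<subseteq> {e. e \<subseteq> {1..n} \<and> card e = 2}"
begin

private lemma ix_eq_iff: "1 \<le> i \<Longrightarrow> i \<le> n \<Longrightarrow> 1 \<le> j \<Longrightarrow> j \<le> n \<Longrightarrow> ix i = ix j \<longleftrightarrow> i = j"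
  using inj_on_eq_iff[OF bij_betw_imp_inj_on[OF ix], of i j] by simp

private lemma edge_bounds: "(i, j) \<in> edge_pairs G \<Longrightarrow> 1 \<le> i \<and> i < j \<and> j \<le> n"
  using edge_pairs_bounds[OF G] by auto

private lemma finite_edges: "finite (edge_pairs G)"
  by (rule finite_subset[of _ "{..n} \<times> {..n}"]) (use edge_bounds in fastforce)+

private lemma point_with_coordinates: "\<exists>x :: real ^ 'n. \<forall>i. 1 \<le> i \<and> i \<le> n \<longrightarrow> x $ ix i = f i"
  using inv_into_f_f[OF bij_betw_imp_inj_on[OF ix]]
  by (intro exI[of _ "\<chi> k. f (inv_into {1..n} ix k)"]) simp

private lemma axis_diff_nonzero:
  "1 \<le> i \<Longrightarrow> i < j \<Longrightarrow> j \<le> n \<Longrightarrow> axis (ix i) (1::real) - axis (ix j) 1 \<noteq> 0"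
  using ix_eq_iff[of i j] by (auto simp: axis_eq_axis)

private lemma braid_normals_nonzero: "p \<in> braid_normals ix n \<Longrightarrow> p \<noteq> 0"
  using axis_diff_nonzero by (auto simp: braid_normals_def)

text \<open>For an edge \<open>ij\<close> nested in \<open>kl\<close>, dominance gives
  \<open>x\<^sub>i \<le> x\<^sub>k\<close> and \<open>x\<^sub>l \<le> x\<^sub>j\<close>, so
  \<open>x\<^sub>i - x\<^sub>j \<le> x\<^sub>k - x\<^sub>l\<close>.\<close>

lemma Shi_ideal_arrangement:
  "ideal_arrangement (braid_normals ix n) (edge_pairs G)
    (\<lambda>(i, j). axis (ix i) 1 - axis (ix j) 1) (\<lambda>_. 1) nested"
proof
  show "inj_on (\<lambda>e. {x :: real ^ 'n. (case e of (i, j) \<Rightarrow> axis (ix i) 1 - axis (ix j) 1) \<bullet> x = (1::real)}) (edge_pairs G)"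
  proof (rule inj_onI, clarify)
    fix i j k l
    assume e: "(i, j) \<in> edge_pairs G" "(k, l) \<in> edge_pairs G"
      and "{x :: real ^ 'n. (axis (ix i) 1 - axis (ix j) 1) \<bullet> x = (1::real)} = {x. (axis (ix k) 1 - axis (ix l) 1) \<bullet> x = 1}"
    then have eq: "x $ ix i - x $ ix j = 1 \<longleftrightarrow> x $ ix k - x $ ix l = 1" for x :: "real ^ 'n"
      by (simp add: inner_axis_diff set_eq_iff)
    \<comment> \<open>Two test points on the first wall, a unit vector at \<open>ix i\<close> and a
      negated one at \<open>ix j\<close>, recover both ends of the edge.\<close>
    have "ix k = ix i"
      using eq[of "axis (ix i) 1"] ix_eq_iff[of i j] edge_bounds[OF e(1)]
      by (auto simp: axis_def split: if_splits)
    moreover have "ix l = ix j"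
      using eq[of "- axis (ix j) 1"] ix_eq_iff[of i j] edge_bounds[OF e(1)]
      by (auto simp: axis_def split: if_splits)
    ultimately show "i = k \<and> j = l"
      using ix_eq_iff[of k i] ix_eq_iff[of l j] edge_bounds[OF e(1)] edge_bounds[OF e(2)] by auto
  qed
next
  fix e f and x :: "real ^ 'n"
  assume ef: "e \<in> edge_pairs G" "f \<in> edge_pairs G" "nested e f" "\<forall>p\<in>braid_normals ix n. 0 < p \<bullet> x"
    and less: "(case f of (i, j) \<Rightarrow> axis (ix i) 1 - axis (ix j) 1) \<bullet> x < 1"
  obtain i j k l where [simp]: "e = (i, j)" "f = (k, l)" by fastforce
  have b: "1 \<le> k" "k \<le> i" "i < j" "j \<le> l" "l \<le> n"
    using ef edge_bounds by (auto simp: nested_def)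
  have dec: "\<And>i j. 1 \<le> i \<Longrightarrow> i < j \<Longrightarrow> j \<le> n \<Longrightarrow> x $ ix j < x $ ix i"
    using ef(4) by (simp add: braid_normals_pos_iff)
  have "x $ ix i \<le> x $ ix k" using dec[of k i] b by (cases "k = i") auto
  moreover have "x $ ix l \<le> x $ ix j" using dec[of j l] b by (cases "j = l") auto
  ultimately show "(case e of (i, j) \<Rightarrow> axis (ix i) 1 - axis (ix j) 1) \<bullet> x < 1"
    using less by (simp add: inner_axis_diff)
next
  fix I assume I: "I \<in> order_ideals nested (edge_pairs G)"
  then have IE: "I \<subseteq> edge_pairs G" by (auto simp: order_ideals_def)
  obtain z :: "nat \<Rightarrow> real" where z: "\<forall>i j. i < j \<and> j \<le> n \<longrightarrow> z i < z j"
    "\<forall>(i, j)\<in>{(i, j) \<in> I. i < j \<and> j \<le> n}. z j - z i < 1"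
    "\<forall>(i, j)\<in>{(i, j) \<in> edge_pairs G - I. i < j \<and> j \<le> n}. 1 < z j - z i"
    using Shi_ideal_realized[OF I, of n] by blast
  \<comment> \<open>Dominant coordinates decrease while \<open>z\<close> increases, hence the
    sign.\<close>
  obtain x :: "real ^ 'n" where x: "\<And>i. 1 \<le> i \<Longrightarrow> i \<le> n \<Longrightarrow> x $ ix i = - z i"
    using point_with_coordinates[of "\<lambda>i. - z i"] by blast
  have "(axis (ix i) 1 - axis (ix j) 1) \<bullet> x = z j - z i" if "(i, j) \<in> edge_pairs G" for i j
    using edge_bounds[OF that] by (simp add: inner_axis_diff x)
  moreover have "\<forall>p\<in>braid_normals ix n. 0 < p \<bullet> x"
    unfolding braid_normals_pos_iff using z(1) x by simp
  ultimately show "\<exists>x. (\<forall>p\<in>braid_normals ix n. 0 < p \<bullet> x) \<and>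
      (\<forall>e\<in>I. (case e of (i, j) \<Rightarrow> axis (ix i) 1 - axis (ix j) 1) \<bullet> x < 1) \<and>
      (\<forall>e\<in>edge_pairs G - I. 1 < (case e of (i, j) \<Rightarrow> axis (ix i) 1 - axis (ix j) 1) \<bullet> x)"
    using z(2,3) IE edge_bounds by (intro exI[of _ x]) fastforce
qed (use finite_braid_normals finite_edges braid_normals_nonzero axis_diff_nonzero edge_bounds in auto)

text \<open>For an edge \<open>ij\<close> nested in \<open>kl\<close>, monotonicity acts on both
  sides: \<open>x\<^sub>1 - x\<^sub>j \<le> x\<^sub>1 - x\<^sub>l < k \<le> i\<close>.\<close>

lemma Ish_ideal_arrangement:
  "ideal_arrangement (braid_normals ix n) (edge_pairs G)
    (\<lambda>(i, j). axis (ix 1) 1 - axis (ix j) 1) (\<lambda>(i, j). real i) nested"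
proof
  show "inj_on (\<lambda>e. {x :: real ^ 'n. (case e of (i, j) \<Rightarrow> axis (ix 1) 1 - axis (ix j) 1) \<bullet> x = (case e of (i, j) \<Rightarrow> real i)})
      (edge_pairs G)"
  proof (rule inj_onI, clarify)
    fix i j k l
    assume e: "(i, j) \<in> edge_pairs G" "(k, l) \<in> edge_pairs G"
      and "{x :: real ^ 'n. (axis (ix 1) 1 - axis (ix j) 1) \<bullet> x = real i} = {x. (axis (ix 1) 1 - axis (ix l) 1) \<bullet> x = real k}"
    then have eq: "x $ ix 1 - x $ ix j = real i \<longleftrightarrow> x $ ix 1 - x $ ix l = real k" for x :: "real ^ 'n"
      by (simp add: inner_axis_diff set_eq_iff)
    have b: "1 \<le> i" "i < j" "j \<le> n" "1 \<le> k" "k < l" "l \<le> n" using edge_bounds e by auto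
    have "ix j \<noteq> ix 1" "ix l \<noteq> ix 1" using b ix_eq_iff[of j 1] ix_eq_iff[of l 1] by auto
    \<comment> \<open>The test point has the single nonzero entry \<open>- i\<close> at
      \<open>ix j\<close>, so it lies on the first wall. As \<open>k \<ge> 1\<close>, lying on the
      second one forces \<open>l = j\<close> and \<open>k = i\<close>.\<close>
    then have "(if ix l = ix j then real i else 0) = real k"
      using eq[of "axis (ix j) (- real i)"] by (auto simp: axis_def split: if_splits)
    then show "i = k \<and> j = l"
      using b ix_eq_iff[of l j] by (auto split: if_splits)
  qed
next
  fix e f and x :: "real ^ 'n"
  assume ef: "e \<in> edge_pairs G" "f \<in> edge_pairs G" "nested e f" "\<forall>p\<in>braid_normals ix n. 0 < p \<bullet> x"
    and less: "(case f of (i, j) \<Rightarrow> axis (ix 1) 1 - axis (ix j) 1) \<bullet> x < (case f of (i, j) \<Rightarrow> real i)"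
  obtain i j k l where [simp]: "e = (i, j)" "f = (k, l)" by fastforce
  have b: "k \<le> i" "1 \<le> j" "j \<le> l" "l \<le> n"
    using ef edge_bounds[of i j] edge_bounds[of k l] by (auto simp: nested_def)
  have "x $ ix l \<le> x $ ix j"
    using ef(4) b by (cases "j = l") (auto simp: braid_normals_pos_iff less_imp_le)
  then show "(case e of (i, j) \<Rightarrow> axis (ix 1) 1 - axis (ix j) 1) \<bullet> x < (case e of (i, j) \<Rightarrow> real i)"
    using less b(1) by (simp add: inner_axis_diff)
next
  fix I assume I: "I \<in> order_ideals nested (edge_pairs G)"
  then have IE: "I \<subseteq> edge_pairs G" by (auto simp: order_ideals_def)
  obtain y :: "nat \<Rightarrow> real" where y: "y 1 = 0" "\<forall>i j. 1 \<le> i \<and> i < j \<and> j \<le> n \<longrightarrow> y i < y j"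
    "\<forall>(i, j)\<in>I. y j < real i" "\<forall>(i, j)\<in>edge_pairs G - I. real i < y j"
    using Ish_ideal_realized[OF I edge_pairs_bounds[OF G]] by blast
  obtain x :: "real ^ 'n" where x: "\<And>i. 1 \<le> i \<Longrightarrow> i \<le> n \<Longrightarrow> x $ ix i = - y i"
    using point_with_coordinates[of "\<lambda>i. - y i"] by blast
  \<comment> \<open>The normalization \<open>y 1 = 0\<close> makes the first coordinate
    vanish.\<close>
  have "(axis (ix 1) 1 - axis (ix j) 1) \<bullet> x = y j" if "(i, j) \<in> edge_pairs G" for i j
    using edge_bounds[OF that] y(1) by (simp add: inner_axis_diff x)
  moreover have "\<forall>p\<in>braid_normals ix n. 0 < p \<bullet> x"
    unfolding braid_normals_pos_iff using y(2) x by simp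
  ultimately show "\<exists>x. (\<forall>p\<in>braid_normals ix n. 0 < p \<bullet> x) \<and>
      (\<forall>e\<in>I. (case e of (i, j) \<Rightarrow> axis (ix 1) 1 - axis (ix j) 1) \<bullet> x < (case e of (i, j) \<Rightarrow> real i)) \<and>
      (\<forall>e\<in>edge_pairs G - I. (case e of (i, j) \<Rightarrow> real i) < (case e of (i, j) \<Rightarrow> axis (ix 1) 1 - axis (ix j) 1) \<bullet> x)"
    using y(3,4) IE by (intro exI[of _ x]) fastforce
next
  fix e assume "e \<in> edge_pairs G"
  moreover obtain i j where "e = (i, j)" by fastforce
  ultimately show "(case e of (i, j) \<Rightarrow> axis (ix 1) 1 - axis (ix j) 1) \<noteq> (0 :: real ^ 'n)"
    and "0 < (case e of (i, j) \<Rightarrow> real i)"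
    using edge_bounds[of i j] axis_diff_nonzero[of 1 j] by auto
qed (simp_all add: finite_braid_normals finite_edges braid_normals_nonzero)

lemma card_dominant_regions_Shi:
  "card {R \<in> dominant_regions ix n (Shi ix n G). int (card (ceilings (Shi ix n G) R)) = c} =
   card {I \<in> order_ideals nested (edge_pairs G). int (card (maximal_elements nested I)) = c}"
proof -
  interpret ideal_arrangement "braid_normals ix n" "edge_pairs G"
    "\<lambda>(i, j). axis (ix i) 1 - axis (ix j) 1" "\<lambda>_. 1" nested
    by (rule Shi_ideal_arrangement)
  have wall: "wall (i, j) = {x. x $ ix i - x $ ix j = 1}" for i j
    unfolding wall_def by (simp add: inner_axis_diff)
  have "wall ` edge_pairs G = {wall (i, j) | i j. i < j \<and> {i, j} \<in> G}"
    by (auto simp: edge_pairs_def)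
  then have "wall ` edge_pairs G = {{x. x $ ix i - x $ ix j = 1} | i j. i < j \<and> {i, j} \<in> G}"
    unfolding wall .
  then have "Shi ix n G = arr" unfolding arr_def Shi_def braid_hyperplanes by simp
  then show ?thesis
    using card_regions_by_ceilings[of c]
    by (simp add: dominant_regions_def open_cone_def braid_normals_pos_iff conj_assoc)
qed

lemma card_dominant_regions_Ish:
  "card {R \<in> dominant_regions ix n (Ish ix n G). int (card (ceilings (Ish ix n G) R)) = c} =
   card {I \<in> order_ideals nested (edge_pairs G). int (card (maximal_elements nested I)) = c}"
proof -
  interpret ideal_arrangement "braid_normals ix n" "edge_pairs G"
    "\<lambda>(i, j). axis (ix 1) 1 - axis (ix j) 1" "\<lambda>(i, j). real i" nested
    by (rule Ish_ideal_arrangement)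
  have wall: "wall (i, j) = {x. x $ ix 1 - x $ ix j = real i}" for i j
    unfolding wall_def by (simp add: inner_axis_diff)
  have "wall ` edge_pairs G = {wall (i, j) | i j. i < j \<and> {i, j} \<in> G}"
    by (auto simp: edge_pairs_def)
  then have "wall ` edge_pairs G = {{x. x $ ix 1 - x $ ix j = real i} | i j. i < j \<and> {i, j} \<in> G}"
    unfolding wall .
  then have "Ish ix n G = arr" unfolding arr_def Ish_def braid_hyperplanes by simp
  then show ?thesis
    using card_regions_by_ceilings[of c]
    by (simp add: dominant_regions_def open_cone_def braid_normals_pos_iff conj_assoc)
qed

end

theorem theorem4p7:
  fixes n :: nat and ix :: "nat \<Rightarrow> 'n::finite" and G :: "nat set set" and c :: int
  assumes "bij_betw ix {1..n} (UNIV :: 'n set)"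
    and "G \<subseteq> {e. e \<subseteq> {1..n} \<and> card e = 2}"
  shows "card {R \<in> dominant_regions ix n (Shi ix n G). int (card (ceilings (Shi ix n G) R)) = c} =
         card {R \<in> dominant_regions ix n (Ish ix n G). int (card (ceilings (Ish ix n G) R)) = c}"
  using card_dominant_regions_Shi[OF assms] card_dominant_regions_Ish[OF assms] by simp

end
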